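(* Let $r \geq 1$ be an integer and let $H = (V, E)$ be an $r$-uniform hypergraph. Then $\mathrm{TH}(H)$ is compact, convex, and satisfies \[ \mathrm{IND}(H) \subseteq \mathrm{TH}(H) \subseteq \mathrm{QIND}(H). \]
   Context: For an integer $r \geq 1$, an $r$-uniform hypergraph $H=(V,E)$ consists of a finite set $V$ and a set $E \subseteq \binom{V}{r}$, where $\binom{V}{r}$ is the set of $r$-element subsets of $V$. A set $I \subseteq V$ is independent in $H$ if no edge of $H$ is contained in $I$. A clique of $H$ is a set $C \subseteq V$ such that every $r$-subset of $C$ is an edge (so every set with fewer than $r$ elements is a clique). For $S\subseteq V$, $\chi_S \in \mathbb{R}^V$ is the characteristic function of $S$; for $f \in \mathbb{R}^V$, $f(S) = \sum_{x \in S} f(x)$. $\mathrm{IND}(H) = \mathrm{conv}\{\chi_I : I \subseteq V \text{ independent}\}\subseteq \mathbb{R}^V$ and $\mathrm{QIND}(H) = \{ f \in [0,1]^V : f(C) \leq r-1 \text{ for every clique } C \subseteq V\}$. For $r \geq 2$ and $x \in V$, the link of $x$ in $H$ is the $(r-1)$-uniform hypergraph $H_x$ with vertex set $V_x = \{ y \in V \setminus\{x\} : \text{there is } e \in E \text{ containing } x \text{ and } y\}$, in which an $(r-1)$-subset $e$ of $V_x$ is an edge if and only if $e \cup \{x\} \in E$. For $A \in \mathbb{R}^{V\times V}$, $A_x \in \mathbb{R}^V$ is the row indexed by $x$, $A_x(y) = A(x,y)$; $f[U]$ is the restriction of $f$ to $U \subseteq V$. Positive semidefinite matrices are always symmetric.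 For a symmetric matrix $A$ with diagonal $a = \mathrm{diag}\,A$, write $R(A) = \begin{pmatrix} 1 & a^{\mathsf T} \\ a & A\end{pmatrix}$. The theta body $\mathrm{TH}(H)$ is defined recursively. For $r = 1$, $\mathrm{TH}(H) = \mathrm{IND}(H)$. For $r \geq 2$, $\mathrm{TH}(H)$ is the set of all $f \in \mathbb{R}^V$ for which there is $F \in \mathbb{R}^{V \times V}$ such that $f = \mathrm{diag}\,F$, $F_x[V_x] \in F(x,x)\,\mathrm{TH}(H_x)$ for every $x \in V$ (no constraint is imposed on row $F_x$ if the link $H_x$ is empty), and $R(F)$ is positive semidefinite. *)

theory Defs
  imports "HOL-Analysis.Analysis"
begin

text \<open>
  The vertex set \<open>V\<close> is an arbitrary (possibly empty) set over a finite type \<open>'a\<close>. Since the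
  theta body is defined by recursion over hypergraphs with shrinking vertex sets, the space of
  real vectors indexed by \<open>U \<subseteq> V\<close> is represented by the coordinate subspace of \<open>real ^ 'a\<close> of
  vectors vanishing outside \<open>U\<close>; matrices indexed by \<open>V \<times> V\<close> are treated likewise.
\<close>

definition vectors_on :: "'a::finite set \<Rightarrow> (real ^ 'a) set" where
  "vectors_on V = {f. \<forall>x. x \<notin> V \<longrightarrow> f $ x = 0}"

definition matrices_on :: "'a::finite set \<Rightarrow> (real ^ 'a ^ 'a) set" where
  "matrices_on V = {A. \<forall>x y. x \<notin> V \<or> y \<notin> V \<longrightarrow> A $ x $ y = 0}"

definition restrict_vec :: "real ^ 'a \<Rightarrow> 'a::finite set \<Rightarrow> real ^ 'a" where
  "restrict_vec f U = (\<chi> x. if x \<in> U then f $ x else 0)"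

definition char_vec :: "'a::finite set \<Rightarrow> real ^ 'a" where
  "char_vec S = (\<chi> x. if x \<in> S then 1 else 0)"

definition diag_vec :: "real ^ 'a ^ 'a \<Rightarrow> real ^ 'a::finite" where
  "diag_vec A = (\<chi> x. A $ x $ x)"

definition positive_semidefinite :: "real ^ 'n ^ 'n::finite \<Rightarrow> bool" where
  "positive_semidefinite A \<longleftrightarrow> transpose A = A \<and> (\<forall>v. 0 \<le> v \<bullet> (A *v v))"

text \<open>
  The bordered matrix \<open>R(A)\<close>; the index \<open>None\<close> is the extra row and column. If \<open>A\<close> is indexed by
  \<open>V \<times> V\<close>, the rows and columns of \<open>R(A)\<close> for indices outside \<open>V\<close> are zero, so they do not affect
  positive semidefiniteness.
\<close>

definition bordered :: "real ^ 'a ^ 'a \<Rightarrow> real ^ 'a option ^ ('a::finite) option" where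
  "bordered A = (\<chi> i j. case (i, j) of
       (None, None) \<Rightarrow> 1
     | (None, Some y) \<Rightarrow> diag_vec A $ y
     | (Some x, None) \<Rightarrow> diag_vec A $ x
     | (Some x, Some y) \<Rightarrow> A $ x $ y)"

definition uniform_hypergraph :: "nat \<Rightarrow> 'a set \<Rightarrow> 'a set set \<Rightarrow> bool" where
  "uniform_hypergraph r V E \<longleftrightarrow> finite V \<and> E \<subseteq> {e. e \<subseteq> V \<and> card e = r}"

definition independent_set :: "'a set \<Rightarrow> 'a set set \<Rightarrow> 'a set \<Rightarrow> bool" where
  "independent_set V E I \<longleftrightarrow> I \<subseteq> V \<and> (\<forall>e\<in>E. \<not> e \<subseteq> I)"

definition hyperclique :: "nat \<Rightarrow> 'a set \<Rightarrow> 'a set set \<Rightarrow> 'a set \<Rightarrow> bool" where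
  "hyperclique r V E C \<longleftrightarrow> C \<subseteq> V \<and> (\<forall>e. e \<subseteq> C \<and> card e = r \<longrightarrow> e \<in> E)"

definition IND :: "'a::finite set \<Rightarrow> 'a set set \<Rightarrow> (real ^ 'a) set" where
  "IND V E = convex hull (char_vec ` {I. independent_set V E I})"

definition QIND :: "nat \<Rightarrow> 'a::finite set \<Rightarrow> 'a set set \<Rightarrow> (real ^ 'a) set" where
  "QIND r V E = {f \<in> vectors_on V. (\<forall>x\<in>V. 0 \<le> f $ x \<and> f $ x \<le> 1) \<and>
     (\<forall>C. hyperclique r V E C \<longrightarrow> (\<Sum>x\<in>C. f $ x) \<le> real r - 1)}"

definition link_verts :: "'a set \<Rightarrow> 'a set set \<Rightarrow> 'a \<Rightarrow> 'a set" where
  "link_verts V E x = {y \<in> V - {x}. \<exists>e\<in>E. x \<in> e \<and> y \<in> e}"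

definition link_edges :: "nat \<Rightarrow> 'a set \<Rightarrow> 'a set set \<Rightarrow> 'a \<Rightarrow> 'a set set" where
  "link_edges r V E x = {e. e \<subseteq> link_verts V E x \<and> card e = r - 1 \<and> e \<union> {x} \<in> E}"

text \<open>The theta body of an \<open>r\<close>-uniform hypergraph; it is left unspecified for \<open>r = 0\<close>.\<close>

fun TH :: "nat \<Rightarrow> 'a::finite set \<Rightarrow> 'a set set \<Rightarrow> (real ^ 'a) set" where
  "TH (Suc 0) V E = IND V E"
| "TH (Suc (Suc n)) V E = {f. \<exists>F \<in> matrices_on V.
     f = diag_vec F \<and>
     (\<forall>x\<in>V. link_verts V E x \<noteq> {} \<longrightarrow>
        restrict_vec (row x F) (link_verts V E x) \<in>
          (\<lambda>g. F $ x $ x *\<^sub>R g) `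
            TH (Suc n) (link_verts V E x) (link_edges (Suc (Suc n)) V E x)) \<and>
     positive_semidefinite (bordered F)}"

end

theory Submission
  imports Defs
begin

text \<open>
  All four claims follow by induction on \<open>r\<close>, because one step of the recursion is a linear lift:
  \<open>TH\<close> is the image, under the linear map taking a matrix to its diagonal, of the set of matrices
  \<open>F\<close> whose bordered matrix is positive semidefinite and whose rows \<open>F\<^sub>x\<close>, restricted to the link of
  \<open>x\<close>, lie in the scaled body \<open>F(x,x) TH(H\<^sub>x)\<close>. Everything about the semidefinite condition is
  contained in its Schur complement form: \<open>F\<close> is symmetric and
  \<open>(diag F \<bullet> v)\<^sup>2 \<le> v \<bullet> F v\<close> for every \<open>v\<close>. At unit vectors it says \<open>F(x,x)\<^sup>2 \<le> F(x,x)\<close>, so the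
  diagonal lies in \<open>[0,1]\<close>. The induction starts with the polytope \<open>IND\<close>, where a clique of a
  \<open>1\<close>-uniform hypergraph consists of vertices that are edges themselves and so misses every
  independent set.

  For convexity, pairs \<open>(c, h)\<close> with \<open>c \<ge> 0\<close> and \<open>h \<in> c T\<close> form a convex cone when \<open>T\<close> is convex
  (\<open>convex_lift_matrices\<close>). For compactness, all entries of \<open>F\<close> are bounded by \<open>1\<close>, and
  the pairs \<open>(c, h)\<close> with \<open>0 \<le> c \<le> 1\<close> and \<open>h \<in> c T\<close> form a compact set when \<open>T\<close> is compact
  (\<open>compact_lift_matrices\<close>).

  An independent set \<open>I\<close> lifts to the rank one matrix \<open>\<chi>\<^sub>I \<chi>\<^sub>I\<^sup>T\<close>; if \<open>x \<in> I\<close>, then the part of \<open>I\<close>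
  in the link of \<open>x\<close> is independent there (\<open>char_vec_in_TH\<close>). Convexity of \<open>TH\<close> then gives all
  of \<open>IND\<close>.

  A set of fewer than \<open>r\<close> vertices satisfies its clique inequality because \<open>f \<le> 1\<close>. For a larger
  clique \<open>C\<close>, removing \<open>x \<in> C\<close> leaves a clique of the link of \<open>x\<close>, so by induction the entries of
  \<open>F\<^sub>x\<close> over \<open>C\<close> add up to at most \<open>(r - 1) F(x,x)\<close>. Summing over \<open>x \<in> C\<close> and taking
  \<open>v = \<chi>\<^sub>C\<close> above gives \<open>f(C)\<^sup>2 \<le> \<chi>\<^sub>C \<bullet> F \<chi>\<^sub>C \<le> (r - 1) f(C)\<close>, hence
  \<open>f(C) \<le> r - 1\<close> (\<open>TH_subset_QIND\<close>).
\<close>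

section \<open>Positive semidefiniteness of the bordered matrix\<close>

lemma sum_UNIV_option:
  fixes h :: "'a::finite option \<Rightarrow> 'b::comm_monoid_add"
  shows "(\<Sum>i\<in>UNIV. h i) = h None + (\<Sum>x\<in>UNIV. h (Some x))"
  by (simp add: UNIV_option_conv sum.reindex)

lemma bordered_quadratic_form:
  fixes A :: "real ^ 'a ^ 'a::finite" and w :: "real ^ 'a option"
  defines "u \<equiv> w $ None" and "v \<equiv> (\<chi> x. w $ Some x)"
  shows "w \<bullet> (bordered A *v w) = u\<^sup>2 + 2 * u * (diag_vec A \<bullet> v) + v \<bullet> (A *v v)"
  by (simp add: inner_vec_def matrix_vector_mult_def bordered_def u_def v_def sum_UNIV_option
      algebra_simps power2_eq_square sum.distrib sum_distrib_left)

lemma transpose_bordered_iff: "transpose (bordered A) = bordered A \<longleftrightarrow> transpose A = A"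
proof
  assume sym: "transpose (bordered A) = bordered A"
  have "A $ x $ y = A $ y $ x" for x y
    using arg_cong[OF sym, of "\<lambda>B. B $ Some x $ Some y"] by (simp add: transpose_def bordered_def)
  then show "transpose A = A"
    by (simp add: transpose_def vec_eq_iff)
qed (auto simp: transpose_def bordered_def vec_eq_iff split: option.split)

text \<open>
  For a fixed vector the quadratic form of \<open>R(A)\<close> is affine in \<open>A\<close>, so this form of the
  condition exhibits the admissible matrices as an intersection of half-spaces.
\<close>

lemma positive_semidefinite_bordered_iff_affine:
  fixes A :: "real ^ 'a ^ 'a::finite"
  shows "positive_semidefinite (bordered A) \<longleftrightarrow>
    transpose A = A \<and> (\<forall>u v. 0 \<le> u\<^sup>2 + 2 * u * (diag_vec A \<bullet> v) + v \<bullet> (A *v v))"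
proof -
  have "(\<forall>w. 0 \<le> w \<bullet> (bordered A *v w)) \<longleftrightarrow>
      (\<forall>u v. 0 \<le> u\<^sup>2 + 2 * u * (diag_vec A \<bullet> v) + v \<bullet> (A *v v))"
  proof (intro iffI allI)
    fix u :: real and v :: "real ^ 'a"
    define w :: "real ^ 'a option" where "w = (\<chi> i. case i of None \<Rightarrow> u | Some x \<Rightarrow> v $ x)"
    assume "\<forall>w. 0 \<le> w \<bullet> (bordered A *v w)"
    then have "0 \<le> w \<bullet> (bordered A *v w)" by blast
    then show "0 \<le> u\<^sup>2 + 2 * u * (diag_vec A \<bullet> v) + v \<bullet> (A *v v)"
      by (simp add: bordered_quadratic_form w_def)
  qed (simp add: bordered_quadratic_form)
  then show ?thesis
    by (simp add: positive_semidefinite_def transpose_bordered_iff)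
qed

text \<open>
  The Schur complement condition: completing the square, the form at \<open>(u, v)\<close> equals
  \<open>(u + diag A \<bullet> v)\<^sup>2 + (v \<bullet> A v - (diag A \<bullet> v)\<^sup>2)\<close>.
\<close>

lemma positive_semidefinite_bordered_iff:
  fixes A :: "real ^ 'a ^ 'a::finite"
  shows "positive_semidefinite (bordered A) \<longleftrightarrow>
    transpose A = A \<and> (\<forall>v. (diag_vec A \<bullet> v)\<^sup>2 \<le> v \<bullet> (A *v v))"
proof -
  have square: "u\<^sup>2 + 2 * u * d + q = (u + d)\<^sup>2 + (q - d\<^sup>2)" for u d q :: real
    by (simp add: power2_eq_square algebra_simps)
  have "(\<forall>u. 0 \<le> u\<^sup>2 + 2 * u * d + q) \<longleftrightarrow> d\<^sup>2 \<le> q" for d q :: real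
  proof
    assume "\<forall>u. 0 \<le> u\<^sup>2 + 2 * u * d + q"
    then have "0 \<le> (- d)\<^sup>2 + 2 * (- d) * d + q" by blast
    then show "d\<^sup>2 \<le> q" by (simp add: power2_eq_square)
  qed (simp add: square)
  then show ?thesis
    unfolding positive_semidefinite_bordered_iff_affine by blast
qed

lemma positive_semidefinite_bordered_diagonal:
  assumes "positive_semidefinite (bordered F)"
  shows "0 \<le> F $ x $ x" "F $ x $ x \<le> 1"
proof -
  have "(diag_vec F \<bullet> axis x 1)\<^sup>2 \<le> axis x 1 \<bullet> (F *v axis x 1)"
    using assms by (simp add: positive_semidefinite_bordered_iff)
  then have *: "F $ x $ x * F $ x $ x \<le> F $ x $ x"
    by (simp add: inner_axis inner_axis' matrix_vector_mult_basis column_def diag_vec_def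
        power2_eq_square)
  then show "0 \<le> F $ x $ x"
    using zero_le_square order_trans by blast
  then show "F $ x $ x \<le> 1"
    using * mult_left_le_imp_le[of "F $ x $ x" "F $ x $ x" 1] by fastforce
qed

text \<open>
  Nonnegativity of the form at \<open>e\<^sub>x \<plusminus> e\<^sub>y\<close> bounds \<open>2 |F(x,y)|\<close> by \<open>F(x,x) + F(y,y) \<le> 2\<close>.
\<close>

lemma positive_semidefinite_bordered_entry:
  assumes psd: "positive_semidefinite (bordered F)"
  shows "\<bar>F $ x $ y\<bar> \<le> 1"
proof -
  have sym: "transpose F = F" and form: "(diag_vec F \<bullet> v)\<^sup>2 \<le> v \<bullet> (F *v v)" for v
    using psd by (auto simp: positive_semidefinite_bordered_iff)
  have nonneg: "0 \<le> v \<bullet> (F *v v)" for v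
    using form[of v] zero_le_power2 order_trans by blast
  have "F $ y $ x = F $ x $ y"
    using arg_cong[OF sym, of "\<lambda>B. B $ x $ y"] by (simp add: transpose_def)
  then have "0 \<le> F $ x $ x + F $ y $ y + 2 * F $ x $ y" "0 \<le> F $ x $ x + F $ y $ y - 2 * F $ x $ y"
    using nonneg[of "axis x 1 + axis y 1"] nonneg[of "axis x 1 - axis y 1"]
    by (simp_all add: inner_axis' matrix_vector_mult_basis column_def inner_left_distrib
        inner_diff_left matrix_vector_right_distrib matrix_vector_mult_diff_distrib)
  with positive_semidefinite_bordered_diagonal[OF psd, of x]
    positive_semidefinite_bordered_diagonal[OF psd, of y]
  show ?thesis by linarith
qed

section \<open>The lifted set of matrices\<close>

text \<open>
  One recursion step, with arbitrary sets \<open>W x\<close> and \<open>T x\<close> for the link of \<open>x\<close> and its theta body.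
\<close>

definition lift_matrices ::
    "'a::finite set \<Rightarrow> ('a \<Rightarrow> 'a set) \<Rightarrow> ('a \<Rightarrow> (real ^ 'a) set) \<Rightarrow> (real ^ 'a ^ 'a) set" where
  "lift_matrices V W T = {F \<in> matrices_on V.
     (\<forall>x\<in>V. W x \<noteq> {} \<longrightarrow> restrict_vec (row x F) (W x) \<in> (\<lambda>g. F $ x $ x *\<^sub>R g) ` T x) \<and>
     positive_semidefinite (bordered F)}"

lemma TH_eq_diag_lift_matrices:
  "TH (Suc (Suc n)) V E = diag_vec ` lift_matrices V (link_verts V E)
     (\<lambda>x. TH (Suc n) (link_verts V E x) (link_edges (Suc (Suc n)) V E x))"
  by (auto simp: lift_matrices_def)

lemma linear_diag_vec: "linear diag_vec"
  by (rule linearI) (simp_all add: diag_vec_def vec_eq_iff)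

lemma linear_restrict_row: "linear (\<lambda>F. restrict_vec (row x F) W)"
  by (rule linearI) (simp_all add: restrict_vec_def row_def vec_eq_iff)

lemma convex_positive_semidefinite_bordered:
  "convex {F :: real ^ 'a ^ 'a::finite. positive_semidefinite (bordered F)}"
proof (rule convexI)
  fix F G :: "real ^ 'a ^ 'a" and s t :: real
  assume F: "F \<in> {F. positive_semidefinite (bordered F)}"
    and G: "G \<in> {F. positive_semidefinite (bordered F)}"
    and st: "0 \<le> s" "0 \<le> t" "s + t = 1"
  have "transpose (s *\<^sub>R F + t *\<^sub>R G) = s *\<^sub>R F + t *\<^sub>R G"
    using F G by (simp add: positive_semidefinite_bordered_iff_affine transpose_def vec_eq_iff)
  moreover have "0 \<le> u\<^sup>2 + 2 * u * (diag_vec (s *\<^sub>R F + t *\<^sub>R G) \<bullet> v) + v \<bullet> ((s *\<^sub>R F + t *\<^sub>R G) *v v)"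
    for u v
  proof -
    let ?q = "\<lambda>A. u\<^sup>2 + 2 * u * (diag_vec A \<bullet> v) + v \<bullet> (A *v v)"
    have "0 \<le> s * ?q F + t * ?q G"
      using F G st by (simp add: positive_semidefinite_bordered_iff_affine)
    also have "\<dots> = (s + t) * u\<^sup>2 + 2 * u * (diag_vec (s *\<^sub>R F + t *\<^sub>R G) \<bullet> v)
        + v \<bullet> ((s *\<^sub>R F + t *\<^sub>R G) *v v)"
      by (simp add: linear_add[OF linear_diag_vec] linear_scale[OF linear_diag_vec]
          inner_left_distrib inner_right_distrib matrix_vector_mult_add_rdistrib
          scaleR_matrix_vector_assoc[symmetric] algebra_simps)
    finally show ?thesis using st by simp
  qed
  ultimately show "s *\<^sub>R F + t *\<^sub>R G \<in> {F. positive_semidefinite (bordered F)}"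
    by (simp add: positive_semidefinite_bordered_iff_affine)
qed

text \<open>
  The pairs \<open>(c, h)\<close> with \<open>c \<ge> 0\<close> and \<open>h \<in> c T\<close> form a convex cone: combining \<open>a g\<close> and \<open>b h\<close>
  gives \<open>a + b\<close> times a weighted mean of \<open>g\<close> and \<open>h\<close>.
\<close>

lemma convex_scaled_add:
  fixes T :: "'b::real_vector set"
  assumes "convex T" "g \<in> T" "h \<in> T" "0 \<le> a" "0 \<le> b"
  shows "a *\<^sub>R g + b *\<^sub>R h \<in> (\<lambda>g. (a + b) *\<^sub>R g) ` T"
proof (cases "a + b = 0")
  case True
  then have "a = 0" "b = 0" using assms(4,5) by linarith+
  then show ?thesis using \<open>g \<in> T\<close> by auto
next
  case False
  define k where "k = (a / (a + b)) *\<^sub>R g + (b / (a + b)) *\<^sub>R h"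
  have "k \<in> T"
    unfolding k_def using assms False
    by (intro convexD) (auto simp: add_divide_distrib[symmetric])
  moreover have "a *\<^sub>R g + b *\<^sub>R h = (a + b) *\<^sub>R k"
    using False by (simp add: k_def scaleR_add_right)
  ultimately show ?thesis by blast
qed

lemma convex_lift_matrices:
  assumes "\<And>x. x \<in> V \<Longrightarrow> convex (T x)"
  shows "convex (lift_matrices V W T)"
proof (rule convexI)
  fix F G :: "real ^ 'a ^ 'a" and s t :: real
  assume F: "F \<in> lift_matrices V W T" and G: "G \<in> lift_matrices V W T"
    and st: "0 \<le> s" "0 \<le> t" "s + t = 1"
  let ?M = "s *\<^sub>R F + t *\<^sub>R G"
  have "?M \<in> matrices_on V"
    using F G by (auto simp: lift_matrices_def matrices_on_def)
  moreover have "positive_semidefinite (bordered ?M)"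
    using F G st convexD[OF convex_positive_semidefinite_bordered, of F G s t]
    by (auto simp: lift_matrices_def)
  moreover have "restrict_vec (row x ?M) (W x) \<in> (\<lambda>g. ?M $ x $ x *\<^sub>R g) ` T x"
    if x: "x \<in> V" "W x \<noteq> {}" for x
  proof -
    obtain g where g: "g \<in> T x" "restrict_vec (row x F) (W x) = F $ x $ x *\<^sub>R g"
      using F x by (auto simp: lift_matrices_def)
    obtain h where h: "h \<in> T x" "restrict_vec (row x G) (W x) = G $ x $ x *\<^sub>R h"
      using G x by (auto simp: lift_matrices_def)
    have "0 \<le> F $ x $ x" "0 \<le> G $ x $ x"
      using F G by (auto simp: lift_matrices_def intro: positive_semidefinite_bordered_diagonal)
    then have scaled: "(s * F $ x $ x) *\<^sub>R g + (t * G $ x $ x) *\<^sub>R h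
        \<in> (\<lambda>g. (s * F $ x $ x + t * G $ x $ x) *\<^sub>R g) ` T x"
      using st g(1) h(1) assms[OF x(1)] by (intro convex_scaled_add) auto
    have "restrict_vec (row x ?M) (W x) = (s * F $ x $ x) *\<^sub>R g + (t * G $ x $ x) *\<^sub>R h"
      by (simp add: linear_add[OF linear_restrict_row] linear_scale[OF linear_restrict_row] g h)
    with scaled show ?thesis by simp
  qed
  ultimately show "?M \<in> lift_matrices V W T"
    by (auto simp: lift_matrices_def)
qed

lemma bounded_positive_semidefinite_bordered:
  "bounded {F :: real ^ 'a ^ 'a::finite. positive_semidefinite (bordered F)}"
proof (rule boundedI)
  fix F :: "real ^ 'a ^ 'a"
  assume "F \<in> {F. positive_semidefinite (bordered F)}"
  then have entry: "\<bar>F $ x $ y\<bar> \<le> 1" for x y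
    by (simp add: positive_semidefinite_bordered_entry)
  have "norm F \<le> (\<Sum>x\<in>UNIV. norm (F $ x))"
    by (simp add: norm_vec_def L2_set_le_sum)
  also have "\<dots> \<le> (\<Sum>x\<in>(UNIV :: 'a set). \<Sum>y\<in>UNIV. \<bar>F $ x $ y\<bar>)"
    by (intro sum_mono norm_le_l1_cart)
  also have "\<dots> \<le> (\<Sum>x\<in>(UNIV :: 'a set). \<Sum>y\<in>(UNIV :: 'a set). 1)"
    by (intro sum_mono entry)
  finally show "norm F \<le> (\<Sum>x\<in>(UNIV :: 'a set). \<Sum>y\<in>(UNIV :: 'a set). 1)" .
qed

lemma continuous_diag_vec: "continuous_on S diag_vec"
  by (rule linear_continuous_on) (simp add: linear_diag_vec linear_conv_bounded_linear[symmetric])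

lemma closed_positive_semidefinite_bordered:
  "closed {F :: real ^ 'a ^ 'a::finite. positive_semidefinite (bordered F)}"
proof -
  have form: "continuous_on UNIV (\<lambda>F :: real ^ 'a ^ 'a. v \<bullet> (F *v v))" for v
    unfolding matrix_vector_mult_def inner_vec_def by (simp, intro continuous_intros)
  have "{F :: real ^ 'a ^ 'a. positive_semidefinite (bordered F)} =
      {F. transpose F = F} \<inter> (\<Inter>v. {F. (diag_vec F \<bullet> v)\<^sup>2 \<le> v \<bullet> (F *v v)})"
    by (auto simp: positive_semidefinite_bordered_iff)
  moreover have "closed {F :: real ^ 'a ^ 'a. transpose F = F}"
    unfolding transpose_def by (intro closed_Collect_eq continuous_intros)
  moreover have "closed {F :: real ^ 'a ^ 'a. (diag_vec F \<bullet> v)\<^sup>2 \<le> v \<bullet> (F *v v)}" for v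
    by (intro closed_Collect_le continuous_intros continuous_diag_vec form)
  ultimately show ?thesis by (simp add: closed_INT closed_Int)
qed

text \<open>
  The dilation \<open>(c, g) \<mapsto> (c, c g)\<close> maps \<open>[0,1] \<times> T x\<close> onto a compact set, and on matrices with
  diagonal in \<open>[0,1]\<close> the row condition says that the pair of \<open>F(x,x)\<close> and the restricted row lies
  in it. So the condition is closed although the scaling factor depends on \<open>F\<close>.
\<close>

lemma compact_lift_matrices:
  assumes T: "\<And>x. x \<in> V \<Longrightarrow> compact (T x)"
  shows "compact (lift_matrices V W T)"
proof -
  define K where "K x = (\<lambda>(c, g). (c, c *\<^sub>R g)) ` ({0..1::real} \<times> T x)" for x
  define R where "R x = (\<lambda>F :: real ^ 'a ^ 'a. (F $ x $ x, restrict_vec (row x F) (W x))) -` K x"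
    for x
  have "closed (R x)" if "x \<in> V" for x
  proof -
    have "compact (K x)"
      unfolding K_def split_def
      by (intro compact_continuous_image continuous_intros compact_Times T that) auto
    then show ?thesis
      unfolding R_def
      by (intro closed_vimage compact_imp_closed continuous_intros linear_continuous_on)
        (auto simp: linear_restrict_row linear_conv_bounded_linear[symmetric])
  qed
  then have "closed (\<Inter>x\<in>{x \<in> V. W x \<noteq> {}}. R x)"
    by (intro closed_INT) auto
  moreover have "closed (matrices_on V :: (real ^ 'a ^ 'a) set)"
    unfolding matrices_on_def imp_conv_disj
    by (intro closed_Collect_all closed_Collect_disj closed_Collect_const closed_Collect_eq
        continuous_intros)
  ultimately have "compact ({F. positive_semidefinite (bordered F)} \<inter>
      (matrices_on V \<inter> (\<Inter>x\<in>{x \<in> V. W x \<noteq> {}}. R x)))"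
    by (intro compact_Int_closed closed_Int)
      (auto simp: compact_eq_bounded_closed closed_positive_semidefinite_bordered
        bounded_positive_semidefinite_bordered)
  moreover have "F \<in> R x \<longleftrightarrow> restrict_vec (row x F) (W x) \<in> (\<lambda>g. F $ x $ x *\<^sub>R g) ` T x"
    if "positive_semidefinite (bordered F)" for F x
    using positive_semidefinite_bordered_diagonal[OF that, of x] 
    by (auto simp: R_def K_def image_iff Bex_def)
  then have "lift_matrices V W T = {F. positive_semidefinite (bordered F)} \<inter>
      (matrices_on V \<inter> (\<Inter>x\<in>{x \<in> V. W x \<noteq> {}}. R x))"
    unfolding lift_matrices_def by blast
  ultimately show ?thesis by simp
qed

section \<open>Convexity and compactness of the theta body\<close>

lemma convex_TH: "convex (TH (Suc n) V E)"
proof (induction n arbitrary: V E)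
  case 0
  then show ?case by (simp add: IND_def convex_convex_hull)
next
  case (Suc n)
  then show ?case
    unfolding TH_eq_diag_lift_matrices
    by (intro convex_linear_image linear_diag_vec convex_lift_matrices)
qed

lemma compact_TH: "compact (TH (Suc n) V E)"
proof (induction n arbitrary: V E)
  case 0
  then show ?case by (simp add: IND_def finite_imp_compact_convex_hull)
next
  case (Suc n)
  then show ?case
    unfolding TH_eq_diag_lift_matrices
    by (intro compact_continuous_image continuous_diag_vec compact_lift_matrices)
qed

section \<open>Independent sets lie in the theta body\<close>

lemma uniform_hypergraph_link:
  fixes V :: "'a::finite set"
  shows "uniform_hypergraph (r - 1) (link_verts V E x) (link_edges r V E x)"
  by (auto simp: uniform_hypergraph_def link_edges_def)

lemma independent_set_empty:
  assumes "uniform_hypergraph (Suc n) V E"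
  shows "independent_set V E {}"
  using assms by (auto simp: independent_set_def uniform_hypergraph_def)

lemma independent_set_link:
  assumes "independent_set V E I" "x \<in> I"
  shows "independent_set (link_verts V E x) (link_edges r V E x) (I \<inter> link_verts V E x)"
  using assms by (auto simp: independent_set_def link_edges_def)

text \<open>
  The witness is \<open>F = \<chi>\<^sub>I \<chi>\<^sub>I\<^sup>T\<close>, for which the Schur complement condition is an equality. Its row at
  \<open>x \<in> I\<close> is \<open>\<chi>\<^sub>I\<close>, which restricts to the characteristic vector of an independent set of the link.
\<close>

lemma char_vec_in_TH:
  assumes "uniform_hypergraph (Suc n) V E" "independent_set V E I"
  shows "char_vec I \<in> TH (Suc n) V E"
  using assms
proof (induction n arbitrary: V E I)
  case 0
  then show ?case by (auto simp: IND_def intro: hull_inc)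
next
  case (Suc n)
  let ?W = "link_verts V E" and ?L = "link_edges (Suc (Suc n)) V E"
  let ?F = "\<chi> x y. (char_vec I :: real ^ 'a) $ x * char_vec I $ y"
  have IV: "I \<subseteq> V" using Suc.prems by (simp add: independent_set_def)
  have link: "uniform_hypergraph (Suc n) (?W x) (?L x)" for x
    using uniform_hypergraph_link[of "Suc (Suc n)" V E x] by simp
  have diag: "diag_vec ?F = char_vec I"
    by (simp add: diag_vec_def char_vec_def vec_eq_iff)
  have "v \<bullet> (?F *v v) = (char_vec I \<bullet> v)\<^sup>2" for v
  proof -
    have "?F *v v = (char_vec I \<bullet> v) *\<^sub>R char_vec I"
      by (simp add: matrix_vector_mult_def vec_eq_iff inner_vec_def sum_distrib_left mult.commute
          mult.left_commute)
    then show ?thesis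
      by (simp add: power2_eq_square inner_commute[of v])
  qed
  moreover have "transpose ?F = ?F"
    by (simp add: transpose_def vec_eq_iff mult.commute)
  ultimately have "positive_semidefinite (bordered ?F)"
    by (simp add: positive_semidefinite_bordered_iff diag)
  moreover have "?F \<in> matrices_on V"
    using IV by (auto simp: matrices_on_def char_vec_def)
  moreover have "restrict_vec (row x ?F) (?W x) \<in> (\<lambda>g. ?F $ x $ x *\<^sub>R g) ` TH (Suc n) (?W x) (?L x)"
    for x
  proof (cases "x \<in> I")
    case True
    have mem: "char_vec (I \<inter> ?W x) \<in> TH (Suc n) (?W x) (?L x)"
      using Suc.IH[OF link independent_set_link[OF Suc.prems(2) True]] .
    have "restrict_vec (row x ?F) (?W x) = ?F $ x $ x *\<^sub>R char_vec (I \<inter> ?W x)"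
      using True by (auto simp: restrict_vec_def row_def char_vec_def vec_eq_iff)
    then show ?thesis using mem by (rule image_eqI)
  next
    case False
    \<comment> \<open>The row is zero, so any point of the link's body serves as witness.\<close>
    have mem: "char_vec {} \<in> TH (Suc n) (?W x) (?L x)"
      using Suc.IH[OF link independent_set_empty[OF link]] .
    have "restrict_vec (row x ?F) (?W x) = ?F $ x $ x *\<^sub>R char_vec {}"
      using False by (auto simp: restrict_vec_def row_def char_vec_def vec_eq_iff)
    then show ?thesis using mem by (rule image_eqI)
  qed
  ultimately have lift: "?F \<in> lift_matrices V ?W (\<lambda>x. TH (Suc n) (?W x) (?L x))"
    unfolding lift_matrices_def by blast
  show ?case
    unfolding TH_eq_diag_lift_matrices using imageI[OF lift, of diag_vec] by (simp only: diag)
qed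

lemma IND_subset_TH:
  assumes "uniform_hypergraph (Suc n) V E"
  shows "IND V E \<subseteq> TH (Suc n) V E"
  unfolding IND_def using char_vec_in_TH[OF assms] convex_TH by (intro hull_minimal) auto

section \<open>The theta body satisfies the clique inequalities\<close>

lemma convex_QIND: "convex (QIND r V E)"
proof (rule convexI)
  fix f g :: "real ^ 'a" and s t :: real
  assume f: "f \<in> QIND r V E" and g: "g \<in> QIND r V E" and st: "0 \<le> s" "0 \<le> t" "s + t = 1"
  have "s *\<^sub>R f + t *\<^sub>R g \<in> vectors_on V"
    using f g by (auto simp: QIND_def vectors_on_def)
  moreover have "0 \<le> (s *\<^sub>R f + t *\<^sub>R g) $ x \<and> (s *\<^sub>R f + t *\<^sub>R g) $ x \<le> 1" if "x \<in> V" for x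
    using f g st that by (auto simp: QIND_def intro: convex_bound_le)
  moreover have "(\<Sum>x\<in>C. (s *\<^sub>R f + t *\<^sub>R g) $ x) \<le> real r - 1" if "hyperclique r V E C" for C
  proof -
    have "s * (\<Sum>x\<in>C. f $ x) + t * (\<Sum>x\<in>C. g $ x) \<le> real r - 1"
      using f g st that by (intro convex_bound_le) (auto simp: QIND_def)
    then show ?thesis by (simp add: sum.distrib sum_distrib_left)
  qed
  ultimately show "s *\<^sub>R f + t *\<^sub>R g \<in> QIND r V E"
    by (auto simp: QIND_def)
qed

lemma IND_subset_QIND_1: "IND V E \<subseteq> QIND (Suc 0) V E"
  unfolding IND_def
proof (rule hull_minimal)
  have "char_vec I \<in> QIND (Suc 0) V E" if I: "independent_set V E I" for I
  proof -
    have "(\<Sum>x\<in>C. (char_vec I :: real ^ 'a) $ x) = 0" if C: "hyperclique (Suc 0) V E C" for C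
    proof (rule sum.neutral, rule ballI)
      fix x assume "x \<in> C"
      then have "{x} \<in> E" using C by (auto simp: hyperclique_def)
      then show "(char_vec I :: real ^ 'a) $ x = 0"
        using I by (auto simp: independent_set_def char_vec_def)
    qed
    moreover have "I \<subseteq> V" using I by (simp add: independent_set_def)
    ultimately show ?thesis
      by (auto simp: QIND_def vectors_on_def char_vec_def)
  qed
  then show "char_vec ` {I. independent_set V E I} \<subseteq> QIND (Suc 0) V E" by auto
qed (rule convex_QIND)

text \<open>
  Any two vertices of a clique with at least \<open>r \<ge> 2\<close> elements extend inside it to an
  \<open>r\<close>-subset, which is an edge; so the other vertices of the clique all belong to the link of \<open>x\<close>.
\<close>

lemma hyperclique_link:
  fixes V :: "'a::finite set"
  assumes C: "hyperclique r V E C" and r: "2 \<le> r" "r \<le> card C" and x: "x \<in> C"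
  shows "hyperclique (r - 1) (link_verts V E x) (link_edges r V E x) (C - {x})"
proof -
  have CV: "C \<subseteq> V" and edge: "\<And>e. e \<subseteq> C \<Longrightarrow> card e = r \<Longrightarrow> e \<in> E"
    using C by (auto simp: hyperclique_def)
  have "C - {x} \<subseteq> link_verts V E x"
  proof
    fix y assume y: "y \<in> C - {x}"
    have "card {x, y} \<le> r" "{x, y} \<subseteq> C" using r x y by auto
    then obtain e where "{x, y} \<subseteq> e" "e \<subseteq> C" "card e = r"
      using exists_subset_between[of "{x, y}" r C] r by auto
    then show "y \<in> link_verts V E x"
      using edge y CV by (auto simp: link_verts_def)
  qed
  moreover have "e \<union> {x} \<in> E" if "e \<subseteq> C - {x}" "card e = r - 1" for e
  proof (rule edge)
    have "x \<notin> e" using that by blast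
    then show "card (e \<union> {x}) = r" using that r by simp
  qed (use that x in auto)
  ultimately show ?thesis
    unfolding hyperclique_def link_edges_def by auto
qed

lemma char_vec_inner: "char_vec C \<bullet> (v :: real ^ 'a::finite) = (\<Sum>x\<in>C. v $ x)"
  by (simp add: inner_vec_def char_vec_def if_distrib if_distribR sum.If_cases cong: if_cong)

text \<open>
  For a clique \<open>C\<close> with at least \<open>r\<close> elements, summing all entries of \<open>F\<close> over \<open>C \<times> C\<close> is the
  crucial step: the link inequalities bound this sum above by \<open>(r - 1) f(C)\<close>, and the Schur
  complement condition at \<open>\<chi>\<^sub>C\<close> bounds it below by \<open>f(C)\<^sup>2\<close>.
\<close>

lemma TH_subset_QIND: "TH (Suc n) V E \<subseteq> QIND (Suc n) V E"
proof (induction n arbitrary: V E)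
  case 0
  then show ?case using IND_subset_QIND_1 by simp
next
  case (Suc n)
  let ?r = "Suc (Suc n)"
  let ?W = "link_verts V E" and ?L = "link_edges ?r V E"
  show ?case
  proof
    fix f assume "f \<in> TH ?r V E"
    then obtain F where F: "F \<in> lift_matrices V ?W (\<lambda>x. TH (Suc n) (?W x) (?L x))"
      and f: "f = diag_vec F"
      unfolding TH_eq_diag_lift_matrices by blast
    then have psd: "positive_semidefinite (bordered F)" and F_on: "F \<in> matrices_on V"
      by (auto simp: lift_matrices_def)
    have fx: "f $ x = F $ x $ x" for x by (simp add: f diag_vec_def)
    have f01: "0 \<le> f $ x" "f $ x \<le> 1" for x
      using positive_semidefinite_bordered_diagonal[OF psd] by (auto simp: fx)
    have "(\<Sum>x\<in>C. f $ x) \<le> real ?r - 1" if C: "hyperclique ?r V E C" for C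
    proof (cases "card C < ?r")
      case True
      have "(\<Sum>x\<in>C. f $ x) \<le> (\<Sum>x\<in>C. 1)" by (intro sum_mono f01)
      also have "\<dots> \<le> real ?r - 1" using True by simp
      finally show ?thesis .
    next
      case False
      have row: "(\<Sum>y\<in>C. F $ x $ y) \<le> (real ?r - 1) * f $ x" if x: "x \<in> C" for x
      proof -
        have clique: "hyperclique (Suc n) (?W x) (?L x) (C - {x})"
          using hyperclique_link[OF C _ _ x] False by simp
        then have sub: "C - {x} \<subseteq> ?W x" by (simp add: hyperclique_def)
        \<comment> \<open>The row of \<open>x\<close> is constrained only if the link of \<open>x\<close> has a vertex.\<close>
        have "C - {x} \<noteq> {}"
        proof
          assume "C - {x} = {}"
          then have "C \<subseteq> {x}" by blast
          then have "card C \<le> 1" using card_mono[of "{x}" C] by simp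
          then show False using False by simp
        qed
        moreover have "x \<in> V" using C x by (auto simp: hyperclique_def)
        ultimately obtain g where "g \<in> TH (Suc n) (?W x) (?L x)"
          and g: "restrict_vec (row x F) (?W x) = F $ x $ x *\<^sub>R g"
          using F sub unfolding lift_matrices_def by blast
        then have "g \<in> QIND (Suc n) (?W x) (?L x)" using Suc.IH by blast
        then have bound: "(\<Sum>y\<in>C - {x}. g $ y) \<le> real n"
          using clique by (auto simp: QIND_def)
        have "F $ x $ y = f $ x * g $ y" if "y \<in> C - {x}" for y
          using arg_cong[OF g, of "\<lambda>v. v $ y"] that sub
          by (auto simp: restrict_vec_def row_def fx)
        then have "(\<Sum>y\<in>C - {x}. F $ x $ y) = f $ x * (\<Sum>y\<in>C - {x}. g $ y)"
          by (simp add: sum_distrib_left)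
        also have "\<dots> \<le> f $ x * real n"
          using bound f01 by (intro mult_left_mono)
        finally show ?thesis
          using x by (simp add: sum.remove[of C x] fx algebra_simps)
      qed
      let ?s = "\<Sum>x\<in>C. f $ x"
      have "(diag_vec F \<bullet> char_vec C)\<^sup>2 \<le> char_vec C \<bullet> (F *v char_vec C)"
        using psd by (simp add: positive_semidefinite_bordered_iff)
      also have "diag_vec F \<bullet> char_vec C = ?s"
        by (simp add: inner_commute[of "diag_vec F"] char_vec_inner f)
      also have "char_vec C \<bullet> (F *v char_vec C) = (\<Sum>x\<in>C. \<Sum>y\<in>C. F $ x $ y)"
        by (simp add: char_vec_inner matrix_vector_mul_component
            inner_commute[of _ "char_vec C"])
      also have "\<dots> \<le> (real ?r - 1) * ?s"
        unfolding sum_distrib_left by (intro sum_mono row)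
      finally have "?s * ?s \<le> (real ?r - 1) * ?s" by (simp add: power2_eq_square)
      moreover have "0 \<le> ?s" by (intro sum_nonneg f01)
      ultimately show ?thesis
        by (cases "?s = 0") auto
    qed
    moreover have "f \<in> vectors_on V"
      using F_on by (simp add: vectors_on_def matrices_on_def fx)
    ultimately show "f \<in> QIND ?r V E"
      using f01 by (simp add: QIND_def)
  qed
qed

section \<open>The sandwich theorem\<close>

theorem theorem2p1:
  fixes r :: nat and V :: "'a::finite set" and E :: "'a set set"
  assumes "r \<ge> 1" and "uniform_hypergraph r V E"
  shows "compact (TH r V E) \<and> convex (TH r V E) \<and>
    IND V E \<subseteq> TH r V E \<and> TH r V E \<subseteq> QIND r V E"
proof -
  obtain n where "r = Suc n" using assms(1) by (cases r) auto
  then show ?thesis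
    using assms(2) by (simp only: compact_TH convex_TH IND_subset_TH TH_subset_QIND simp_thms)
qed

end
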